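(* Let $\langle F,R,\langle\mathcal V,\mathcal E\rangle\rangle$ be a linear co-design problem with nodes $\mathcal V=\{1,\dots,N\}$. For each node $d\in\mathcal V$, let $\mathrm{ldp}_d=\{z_d\in\mathbb{R}^{n_d}\mid M_d z_d\ge m_d\}$ be an $\mathbf H$-representation (description by finitely many linear inequalities) of its component feasible set (including the port-domain constraints $z_d\in F_d\times R_d$), where $z_d=[x_{F_d}^\top,x_{R_d}^\top]^\top$. Let $z_{\mathrm{global}}=[z_1^\top,\dots,z_N^\top]^\top$, $M_{\mathrm{blk}}=\operatorname{block-diag}(M_1,\dots,M_N)$, $m_{\mathrm{blk}}=[m_1^\top,\dots,m_N^\top]^\top$, and let $E z_{\mathrm{global}}=0$ be the collection of all wiring equalities induced by the edges $\mathcal E$ (each row of $E$ has exactly one $+1$ and one $-1$, equating a connected resource coordinate with the connected functionality coordinate). Then the full-space system-level feasible set of the linear co-design problem is the polyhedron $$\mathrm{ldp}_{\mathrm{tot}}^{\mathrm{full}}=\{z_{\mathrm{global}}\mid M_{\mathrm{blk}}z_{\mathrm{global}}\ge m_{\mathrm{blk}},\ E z_{\mathrm{global}}=0\}.$$ If $S_{\mathrm{ext}}$ is a selection matrix extracting the external ports $z_{\mathrm{ext}}=[x_F^\top,x_R^\top]^\top$ from $z_{\mathrm{global}}$, then the induced external-port system-level feasible set is the projection $$\mathrm{ldp}_{\mathrm{tot}}=\{z_{\mathrm{ext}}\mid\exists z_{\mathrm{global}}\in\mathrm{ldp}_{\mathrm{tot}}^{\mathrm{full}}\ \text{s.t.}\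 z_{\mathrm{ext}}=S_{\mathrm{ext}}z_{\mathrm{global}}\}.$$
   Context: A Euclidean sub-poset is a subset of some $\mathbb{R}^n_{\ge 0}$ with the restricted componentwise order $\preceq$. For posets $F,R$, a design problem (DP) from $F$ (functionalities) to $R$ (resources) is an upper set of $F^{\mathrm{op}}\times R$, i.e. a set of feasible pairs $\langle x_F,x_R\rangle$ closed under decreasing $x_F$ in $F$ and increasing $x_R$ in $R$. A linear design problem (LDP) is a DP between Euclidean sub-posets whose set of feasible pairs is a polyhedron (finite intersection of closed halfspaces) in the underlying Euclidean space. A linear co-design problem (LCDP) $\langle F,R,\langle\mathcal V,\mathcal E\rangle\rangle$ consists of a multigraph such that: (i) each node $d\in\mathcal V$ is an LDP with feasible set $\mathrm{ldp}_d\subseteq F_d\times R_d$, where $F_d=\prod_i F_{d,i}$ and $R_d=\prod_j R_{d,j}$ are finite products of Euclidean sub-posets (the ports of $d$); (ii) each edge is a pair $\langle\langle d_1,i_1\rangle,\langle d_2,j_2\rangle\rangle$ linking the $i_1$-th resource port of $d_1$ to the $j_2$-th functionality port of $d_2$, where $R_{d_1,i_1}=F_{d_2,j_2}$ as posets, and it represents the constraint $x_{R_{d_1,i_1}}\preceq x_{F_{d_2,j_2}}$; (iii) the system-level functionality space $F$ (resource space $R$) is the product of all unconnected functionality (resource) ports; these unconnected ports are the external ports. The full-space system-level feasible set consists of all assignments of values to all ports that are feasible for every component and in which connected port coordinates are identified by equality. The induced external-port system-level feasible set of the LCDP is the set of $\langle x_F,x_R\rangle\in F\times R$ for which there is an assignment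 of values to all ports of all nodes that extends $\langle x_F,x_R\rangle$ on the external ports, lies in $\mathrm{ldp}_d$ for every $d$, and satisfies the inequality of every edge.
   Formalization: The projection claim is proved only when every edge has an endpoint port lying on no other edge (one-to-one wiring, fan-out and fan-in included); for other wirings it can fail, since the induced set uses edge inequalities while the polyhedron uses equalities. *)

theory Defs
  imports "Jordan_Normal_Form.Matrix"
begin

section \<open>Design problems on Euclidean sub-posets\<close>

text \<open>A Euclidean sub-poset is the pair of its ambient dimension and its carrier; its order is the
  componentwise order \<open>(\<le>)\<close> on vectors. Posets are equal iff these pairs are equal.\<close>

type_synonym eposet = "nat \<times> real vec set"

definition euclidean_subposet :: "eposet \<Rightarrow> bool" where
  "euclidean_subposet P \<longleftrightarrow> snd P \<subseteq> {x \<in> carrier_vec (fst P). 0\<^sub>v (fst P) \<le> x}"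

definition prod_carrier :: "eposet list \<Rightarrow> real vec list set" where
  "prod_carrier Ps = listset (map snd Ps)"

definition prod_le :: "real vec list \<Rightarrow> real vec list \<Rightarrow> bool" where
  "prod_le = list_all2 (\<le>)"

definition prod_dim :: "eposet list \<Rightarrow> nat" where
  "prod_dim Ps = sum_list (map fst Ps)"

definition design_problem ::
    "'a set \<Rightarrow> ('a \<Rightarrow> 'a \<Rightarrow> bool) \<Rightarrow> 'b set \<Rightarrow> ('b \<Rightarrow> 'b \<Rightarrow> bool) \<Rightarrow> ('a \<times> 'b) set \<Rightarrow> bool" where
  "design_problem F leF R leR D \<longleftrightarrow>
     D \<subseteq> F \<times> R \<and>
     (\<forall>xF xR. (xF, xR) \<in> D \<longrightarrow>
        (\<forall>yF \<in> F. \<forall>yR \<in> R. leF yF xF \<longrightarrow> leR xR yR \<longrightarrow> (yF, yR) \<in> D))"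

text \<open>The normal vector \<open>a\<close> of a halfspace may be zero. For \<open>n > 0\<close> this does not change the class
  of polyhedra; for \<open>n = 0\<close> it makes the empty set a polyhedron.\<close>

definition halfspace_in :: "nat \<Rightarrow> real vec set \<Rightarrow> bool" where
  "halfspace_in n H \<longleftrightarrow> (\<exists>a \<in> carrier_vec n. \<exists>b. H = {x \<in> carrier_vec n. b \<le> a \<bullet> x})"

definition polyhedron_in :: "nat \<Rightarrow> real vec set \<Rightarrow> bool" where
  "polyhedron_in n S \<longleftrightarrow>
     (\<exists>\<H>. finite \<H> \<and> (\<forall>H \<in> \<H>. halfspace_in n H) \<and> S = carrier_vec n \<inter> \<Inter>\<H>)"

definition vconcat :: "real vec list \<Rightarrow> real vec" where
  "vconcat vs = foldr (@\<^sub>v) vs (0\<^sub>v 0)"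

text \<open>\<open>stack\<close> forms the column \<open>[x\<^sub>F, x\<^sub>R]\<close> from tuples of port values. It identifies a product of
  ports of given dimensions with a subset of a single Euclidean space.\<close>

definition stack :: "real vec list \<times> real vec list \<Rightarrow> real vec" where
  "stack x = vconcat (fst x) @\<^sub>v vconcat (snd x)"

record dp_node =
  func_ports :: "eposet list"
  res_ports :: "eposet list"
  ldp :: "(real vec list \<times> real vec list) set"

definition node_dim :: "dp_node \<Rightarrow> nat" where
  "node_dim d = prod_dim (func_ports d) + prod_dim (res_ports d)"

definition linear_design_problem :: "dp_node \<Rightarrow> bool" where
  "linear_design_problem d \<longleftrightarrow>
     (\<forall>P \<in> set (func_ports d) \<union> set (res_ports d). euclidean_subposet P) \<and>
     design_problem (prod_carrier (func_ports d)) prod_le (prod_carrier (res_ports d)) prod_le (ldp d) \<and>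
     polyhedron_in (node_dim d) (stack ` ldp d)"


section \<open>Linear co-design problems\<close>

text \<open>Nodes and ports are numbered from \<open>0\<close>, and a port is the pair (node, position). An edge
  \<open>((d\<^sub>1, i\<^sub>1), (d\<^sub>2, j\<^sub>2))\<close> runs from a resource port to a functionality port. Parallel edges between
  two nodes are distinguished by their ports.\<close>

type_synonym port = "nat \<times> nat"

record codesign =
  nodes :: "dp_node list"
  edges :: "(port \<times> port) set"

definition func_port :: "codesign \<Rightarrow> port \<Rightarrow> eposet" where
  "func_port L p = func_ports (nodes L ! fst p) ! snd p"

definition res_port :: "codesign \<Rightarrow> port \<Rightarrow> eposet" where
  "res_port L p = res_ports (nodes L ! fst p) ! snd p"

definition all_func :: "codesign \<Rightarrow> port list" where
  "all_func L = [(d, j). d \<leftarrow> [0..<length (nodes L)], j \<leftarrow> [0..<length (func_ports (nodes L ! d))]]"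

definition all_res :: "codesign \<Rightarrow> port list" where
  "all_res L = [(d, i). d \<leftarrow> [0..<length (nodes L)], i \<leftarrow> [0..<length (res_ports (nodes L ! d))]]"

definition linear_codesign_problem :: "codesign \<Rightarrow> bool" where
  "linear_codesign_problem L \<longleftrightarrow>
     (\<forall>d \<in> set (nodes L). linear_design_problem d) \<and>
     (\<forall>(r, f) \<in> edges L. r \<in> set (all_res L) \<and> f \<in> set (all_func L) \<and> res_port L r = func_port L f)"

definition ext_func :: "codesign \<Rightarrow> port list" where
  "ext_func L = filter (\<lambda>p. p \<notin> snd ` edges L) (all_func L)"

definition ext_res :: "codesign \<Rightarrow> port list" where
  "ext_res L = filter (\<lambda>p. p \<notin> fst ` edges L) (all_res L)"

definition system_func :: "codesign \<Rightarrow> eposet list" where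
  "system_func L = map (func_port L) (ext_func L)"

definition system_res :: "codesign \<Rightarrow> eposet list" where
  "system_res L = map (res_port L) (ext_res L)"

text \<open>An assignment lists, for each node, the values of its functionality and resource ports.\<close>

type_synonym assignment = "(real vec list \<times> real vec list) list"

definition fval :: "assignment \<Rightarrow> port \<Rightarrow> real vec" where
  "fval z p = fst (z ! fst p) ! snd p"

definition rval :: "assignment \<Rightarrow> port \<Rightarrow> real vec" where
  "rval z p = snd (z ! fst p) ! snd p"

definition componentwise_feasible :: "codesign \<Rightarrow> assignment set" where
  "componentwise_feasible L = listset (map ldp (nodes L))"

definition full_feasible :: "codesign \<Rightarrow> assignment set" where
  "full_feasible L = {z \<in> componentwise_feasible L. \<forall>(r, f) \<in> edges L. rval z r = fval z f}"

definition ext_feasible :: "codesign \<Rightarrow> (real vec list \<times> real vec list) set" where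
  "ext_feasible L =
     {(xF, xR). xF \<in> prod_carrier (system_func L) \<and> xR \<in> prod_carrier (system_res L) \<and>
        (\<exists>z \<in> componentwise_feasible L.
           map (fval z) (ext_func L) = xF \<and> map (rval z) (ext_res L) = xR \<and>
           (\<forall>(r, f) \<in> edges L. rval z r \<le> fval z f))}"

text \<open>Every edge has an endpoint that lies on no other edge. This holds in particular when each port
  is connected at most once, but also allows fan-out from a resource port and fan-in to a
  functionality port. Without it, edge inequalities cannot always be tightened to equalities: let
  two resource ports without functionalities demand \<open>r\<^sub>1 \<ge> 0\<close> and \<open>r\<^sub>2 \<ge> 1\<close>, let two functionality
  ports without resources provide \<open>f\<^sub>1 \<le> 0\<close> and \<open>f\<^sub>2 \<le> 1\<close>, and connect \<open>r\<^sub>1\<close> to \<open>f\<^sub>1\<close> and to \<open>f\<^sub>2\<close>, and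
  \<open>r\<^sub>2\<close> to \<open>f\<^sub>2\<close>.\<close>

definition star_wired :: "codesign \<Rightarrow> bool" where
  "star_wired L \<longleftrightarrow>
     (\<forall>(r, f) \<in> edges L. (\<forall>f'. (r, f') \<in> edges L \<longrightarrow> f' = f) \<or> (\<forall>r'. (r', f) \<in> edges L \<longrightarrow> r' = r))"


section \<open>Global coordinates\<close>

definition global_dim :: "codesign \<Rightarrow> nat" where
  "global_dim L = sum_list (map node_dim (nodes L))"

definition global_vec :: "assignment \<Rightarrow> real vec" where
  "global_vec z = vconcat (map stack z)"

definition node_offset :: "codesign \<Rightarrow> nat \<Rightarrow> nat" where
  "node_offset L d = sum_list (map node_dim (take d (nodes L)))"

text \<open>\<open>func_coord L p k\<close> and \<open>res_coord L p k\<close> are the positions of the \<open>k\<close>-th coordinate of port \<open>p\<close>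
  in the global vector.\<close>

definition func_coord :: "codesign \<Rightarrow> port \<Rightarrow> nat \<Rightarrow> nat" where
  "func_coord L p k =
     node_offset L (fst p) + prod_dim (take (snd p) (func_ports (nodes L ! fst p))) + k"

definition res_coord :: "codesign \<Rightarrow> port \<Rightarrow> nat \<Rightarrow> nat" where
  "res_coord L p k =
     node_offset L (fst p) + prod_dim (func_ports (nodes L ! fst p))
       + prod_dim (take (snd p) (res_ports (nodes L ! fst p))) + k"

definition wires :: "codesign \<Rightarrow> (nat \<times> nat) set" where
  "wires L = {(res_coord L r k, func_coord L f k) | r f k. (r, f) \<in> edges L \<and> k < fst (res_port L r)}"

definition is_wire_row :: "nat \<Rightarrow> nat \<times> nat \<Rightarrow> real vec \<Rightarrow> bool" where
  "is_wire_row n w v \<longleftrightarrow>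
     v = unit_vec n (fst w) - unit_vec n (snd w) \<or> v = unit_vec n (snd w) - unit_vec n (fst w)"

text \<open>The order of the rows, their signs and repetitions are left open.\<close>

definition wiring_matrix :: "codesign \<Rightarrow> real mat \<Rightarrow> bool" where
  "wiring_matrix L E \<longleftrightarrow>
     dim_col E = global_dim L \<and>
     (\<forall>v \<in> set (rows E). \<exists>w \<in> wires L. is_wire_row (global_dim L) w v) \<and>
     (\<forall>w \<in> wires L. \<exists>v \<in> set (rows E). is_wire_row (global_dim L) w v)"

definition ext_coords :: "codesign \<Rightarrow> nat list" where
  "ext_coords L =
     [func_coord L p k. p \<leftarrow> ext_func L, k \<leftarrow> [0..<fst (func_port L p)]] @
     [res_coord L p k. p \<leftarrow> ext_res L, k \<leftarrow> [0..<fst (res_port L p)]]"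

definition ext_selection :: "codesign \<Rightarrow> real mat" where
  "ext_selection L = mat_of_rows (global_dim L) (map (unit_vec (global_dim L)) (ext_coords L))"

definition H_representation :: "nat \<Rightarrow> real vec set \<Rightarrow> real mat \<Rightarrow> real vec \<Rightarrow> bool" where
  "H_representation n S M m \<longleftrightarrow>
     dim_col M = n \<and> dim_vec m = dim_row M \<and> S = {z \<in> carrier_vec n. M *\<^sub>v z \<ge> m}"

end

theory Submission
  imports Defs
begin

text \<open>The full-space part is bookkeeping about coordinates. Choosing a feasible point of every node
  independently amounts to a product of polyhedra, and the product of two \<open>H\<close>-represented sets is
  \<open>H\<close>-represented by the block-diagonal matrix and the stacked right-hand side
  (\<open>H_representation_two_blocks\<close>, iterated in \<open>H_representation_blocks\<close>). Every port occupies a block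
  of consecutive global coordinates (\<open>func_coordinate\<close>, \<open>res_coordinate\<close>), so a row of \<open>E\<close> is orthogonal
  to a global vector iff the two coordinates of its wire agree; the kernel of \<open>E\<close> therefore expresses
  exactly the equality of connected ports (\<open>wiring_matrix_kernel_iff\<close>). A kernel is a polyhedron, being
  cut out by \<open>E z \<ge> 0\<close> and \<open>- E z \<ge> 0\<close>, and so is its intersection with the product.

  The external-port part carries the order-theoretic content: the induced feasible set is defined by
  edge inequalities, the projection by edge equalities. Equalities imply inequalities, by reflexivity.
  Conversely, the feasible set of a node is closed under lowering functionalities and raising
  resources. An inequality \<open>x\<^sub>r \<le> x\<^sub>f\<close> along an edge can thus be turned into an equality either by
  lowering \<open>x\<^sub>f\<close> to \<open>x\<^sub>r\<close> or by raising \<open>x\<^sub>r\<close> to \<open>x\<^sub>f\<close>; both values lie in the common poset of the two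
  ports. When the edges form disjoint stars, all edges can be tightened at once: the value at the
  centre of each star is kept and copied to all of its leaves (\<open>star_copy\<close>, \<open>star_wired_tighten\<close>).
  External ports lie on no edge and keep their values, so the external point does not change.\<close>

section \<open>Cartesian products and concatenation\<close>

lemma listset_iff_list_all2: "xs \<in> listset As \<longleftrightarrow> list_all2 (\<in>) xs As"
  by (induction As arbitrary: xs) (auto simp: set_Cons_def list_all2_Cons2)

lemma listset_map_iff:
  "xs \<in> listset (map S as) \<longleftrightarrow> length xs = length as \<and> (\<forall>i < length as. xs ! i \<in> S (as ! i))"
  by (auto simp: listset_iff_list_all2 list_all2_conv_all_nth)

text \<open>Moves the stacking of port values inside the product over the nodes, so that the set of
  componentwise feasible global vectors becomes a product of the \<open>H\<close>-represented sets.\<close>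

lemma map_image_listset: "map f ` listset As = listset (map ((`) f) As)"
proof (induction As)
  case Nil
  show ?case by simp
next
  case (Cons A As)
  have "map f ` set_Cons A (listset As) = set_Cons (f ` A) (map f ` listset As)"
    by (force simp: set_Cons_def)
  with Cons show ?case by simp
qed

lemma list_of_vec_inject: "list_of_vec v = list_of_vec w \<longleftrightarrow> v = w"
  by (metis vec_list)

lemma vconcat_Nil: "vconcat [] = 0\<^sub>v 0"
  by (simp add: vconcat_def)

lemma vconcat_Cons: "vconcat (v # vs) = v @\<^sub>v vconcat vs"
  by (simp add: vconcat_def)

lemma list_of_vec_vconcat: "list_of_vec (vconcat vs) = concat (map list_of_vec vs)"
  by (induction vs) (simp_all add: vconcat_Nil vconcat_Cons)

lemma dim_vconcat: "dim_vec (vconcat vs) = sum_list (map dim_vec vs)"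
  by (induction vs) (simp_all add: vconcat_Nil vconcat_Cons)

lemma vconcat_append: "vconcat (us @ vs) = vconcat us @\<^sub>v vconcat vs"
  by (simp flip: list_of_vec_inject add: list_of_vec_vconcat)

text \<open>The positions in the global vector are prefix sums of dimensions. This lemma is applied at two
  levels: to the nodes within the global vector and to the ports within a node.\<close>

lemma vconcat_index:
  assumes "i < length vs" and "k < dim_vec (vs ! i)"
  shows "sum_list (map dim_vec (take i vs)) + k < dim_vec (vconcat vs)"
    and "vconcat vs $ (sum_list (map dim_vec (take i vs)) + k) = vs ! i $ k"
proof -
  have "sum_list (map dim_vec (take i vs)) + k < dim_vec (vconcat vs) \<and>
      vconcat vs $ (sum_list (map dim_vec (take i vs)) + k) = vs ! i $ k"
    using assms
  proof (induction vs arbitrary: i)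
    case (Cons v vs)
    then show ?case
      by (cases i) (auto simp: vconcat_Cons)
  qed simp
  then show "sum_list (map dim_vec (take i vs)) + k < dim_vec (vconcat vs)"
    and "vconcat vs $ (sum_list (map dim_vec (take i vs)) + k) = vs ! i $ k" by auto
qed

text \<open>Viewing a node vector as one concatenation over functionalities followed by resources lets
  \<open>vconcat_index\<close> locate both kinds of ports.\<close>

lemma stack_eq_vconcat: "stack x = vconcat (fst x @ snd x)"
  by (simp add: stack_def vconcat_append)


section \<open>Polyhedra and products of \<open>H\<close>-representations\<close>

lemma polyhedron_in_Int:
  assumes "polyhedron_in n S" and "polyhedron_in n T"
  shows "polyhedron_in n (S \<inter> T)"
proof -
  obtain HS where HS: "finite HS" "\<forall>H \<in> HS. halfspace_in n H" "S = carrier_vec n \<inter> \<Inter>HS"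
    using assms(1) unfolding polyhedron_in_def by blast
  obtain HT where HT: "finite HT" "\<forall>H \<in> HT. halfspace_in n H" "T = carrier_vec n \<inter> \<Inter>HT"
    using assms(2) unfolding polyhedron_in_def by blast
  have "S \<inter> T = carrier_vec n \<inter> \<Inter>(HS \<union> HT)"
    using HS(3) HT(3) by auto
  then show ?thesis
    unfolding polyhedron_in_def using HS(1,2) HT(1,2) by (intro exI[of _ "HS \<union> HT"]) auto
qed

lemma polyhedron_of_H_representation:
  assumes "H_representation n S M m"
  shows "polyhedron_in n S"
proof -
  define H where "H i = {x \<in> carrier_vec n. m $ i \<le> row M i \<bullet> x}" for i
  have M: "dim_col M = n" "dim_vec m = dim_row M" "S = {z \<in> carrier_vec n. M *\<^sub>v z \<ge> m}"
    using assms unfolding H_representation_def by auto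
  have "halfspace_in n (H i)" for i
    unfolding halfspace_in_def H_def using M(1) row_carrier[of M i] by blast
  moreover have "S = carrier_vec n \<inter> \<Inter>(H ` {..<dim_row M})"
    unfolding M(3) H_def using M(2) by (auto simp: less_eq_vec_def)
  ultimately show ?thesis
    unfolding polyhedron_in_def by (intro exI[of _ "H ` {..<dim_row M}"]) auto
qed

lemma polyhedron_kernel:
  assumes "dim_col E = n"
  shows "polyhedron_in n {z \<in> carrier_vec n. E *\<^sub>v z = (0\<^sub>v (dim_row E) :: real vec)}"
proof -
  have neg: "(- E *\<^sub>v z) $ i = - ((E *\<^sub>v z) $ i)" if "z \<in> carrier_vec n" "i < dim_row E" for z i
    using that assms by simp
  have "E *\<^sub>v z = 0\<^sub>v (dim_row E) \<longleftrightarrow> 0\<^sub>v (dim_row E) \<le> E *\<^sub>v z \<and> 0\<^sub>v (dim_row E) \<le> - E *\<^sub>v z"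
    if "z \<in> carrier_vec n" for z
  proof -
    have "E *\<^sub>v z = 0\<^sub>v (dim_row E) \<longleftrightarrow> (\<forall>i < dim_row E. (E *\<^sub>v z) $ i = 0)"
      by (auto simp: vec_eq_iff simp del: index_mult_mat_vec)
    also have "\<dots> \<longleftrightarrow> (\<forall>i < dim_row E. 0 \<le> (E *\<^sub>v z) $ i) \<and> (\<forall>i < dim_row E. 0 \<le> (- E *\<^sub>v z) $ i)"
      using neg[OF that] by (metis antisym neg_0_le_iff_le order_refl)
    finally show ?thesis
      by (simp add: less_eq_vec_def)
  qed
  then have "{z \<in> carrier_vec n. E *\<^sub>v z = 0\<^sub>v (dim_row E)}
      = {z \<in> carrier_vec n. E *\<^sub>v z \<ge> 0\<^sub>v (dim_row E)} \<inter> {z \<in> carrier_vec n. - E *\<^sub>v z \<ge> 0\<^sub>v (dim_row E)}"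
    (is "_ = ?P \<inter> ?Q")
    by blast
  moreover have "polyhedron_in n ?P"
    by (rule polyhedron_of_H_representation[where M = E and m = "0\<^sub>v (dim_row E)"])
      (simp add: H_representation_def assms)
  moreover have "polyhedron_in n ?Q"
    by (rule polyhedron_of_H_representation[where M = "- E" and m = "0\<^sub>v (dim_row E)"])
      (simp add: H_representation_def assms)
  ultimately show ?thesis
    by (simp only: polyhedron_in_Int)
qed

text \<open>The off-diagonal zero blocks decouple the two groups of variables, so the joint inequality system
  holds for \<open>x @\<^sub>v y\<close> iff each system holds for its own part.\<close>

lemma H_representation_two_blocks:
  assumes "H_representation n\<^sub>1 S\<^sub>1 M\<^sub>1 m\<^sub>1" and "H_representation n\<^sub>2 S\<^sub>2 M\<^sub>2 m\<^sub>2"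
  shows "H_representation (n\<^sub>1 + n\<^sub>2) {x @\<^sub>v y | x y. x \<in> S\<^sub>1 \<and> y \<in> S\<^sub>2}
    (four_block_mat M\<^sub>1 (0\<^sub>m (dim_row M\<^sub>1) (dim_col M\<^sub>2)) (0\<^sub>m (dim_row M\<^sub>2) (dim_col M\<^sub>1)) M\<^sub>2)
    (m\<^sub>1 @\<^sub>v m\<^sub>2)"
    (is "H_representation _ ?S ?M _")
proof -
  have 1: "dim_col M\<^sub>1 = n\<^sub>1" "dim_vec m\<^sub>1 = dim_row M\<^sub>1" "S\<^sub>1 = {z \<in> carrier_vec n\<^sub>1. m\<^sub>1 \<le> M\<^sub>1 *\<^sub>v z}"
    and 2: "dim_col M\<^sub>2 = n\<^sub>2" "dim_vec m\<^sub>2 = dim_row M\<^sub>2" "S\<^sub>2 = {z \<in> carrier_vec n\<^sub>2. m\<^sub>2 \<le> M\<^sub>2 *\<^sub>v z}"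
    using assms unfolding H_representation_def by auto
  have le: "m\<^sub>1 @\<^sub>v m\<^sub>2 \<le> ?M *\<^sub>v (x @\<^sub>v y) \<longleftrightarrow> m\<^sub>1 \<le> M\<^sub>1 *\<^sub>v x \<and> m\<^sub>2 \<le> M\<^sub>2 *\<^sub>v y"
    if "x \<in> carrier_vec n\<^sub>1" "y \<in> carrier_vec n\<^sub>2" for x y
  proof -
    have "?M *\<^sub>v (x @\<^sub>v y) = M\<^sub>1 *\<^sub>v x @\<^sub>v M\<^sub>2 *\<^sub>v y"
    proof -
      have M: "M\<^sub>1 \<in> carrier_mat (dim_row M\<^sub>1) n\<^sub>1" "M\<^sub>2 \<in> carrier_mat (dim_row M\<^sub>2) n\<^sub>2"
        using 1(1) 2(1) by auto
      have zero: "0\<^sub>m k n *\<^sub>v w = 0\<^sub>v k" if "w \<in> carrier_vec n" for k n and w :: "real vec"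
        using that by (intro eq_vecI) auto
      show ?thesis
        unfolding 1(1) 2(1) four_block_mat_mult_vec[OF M(1) zero_carrier_mat zero_carrier_mat M(2) that]
          zero[OF that(1)] zero[OF that(2)]
        using M that by (simp only: left_zero_vec[OF mult_mat_vec_carrier] right_zero_vec[OF mult_mat_vec_carrier])
    qed
    moreover have "m\<^sub>1 \<in> carrier_vec (dim_row M\<^sub>1)" and "M\<^sub>1 *\<^sub>v x \<in> carrier_vec (dim_row M\<^sub>1)"
      using 1(2) by (auto intro: carrier_vecI)
    ultimately show ?thesis
      by (simp only: append_vec_le)
  qed
  have "?S = {z \<in> carrier_vec (n\<^sub>1 + n\<^sub>2). m\<^sub>1 @\<^sub>v m\<^sub>2 \<le> ?M *\<^sub>v z}"
  proof (intro equalityI subsetI)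
    fix z
    assume "z \<in> ?S"
    then obtain x y where z: "z = x @\<^sub>v y" and xy: "x \<in> S\<^sub>1" "y \<in> S\<^sub>2" by blast
    then show "z \<in> {z \<in> carrier_vec (n\<^sub>1 + n\<^sub>2). m\<^sub>1 @\<^sub>v m\<^sub>2 \<le> ?M *\<^sub>v z}"
      using le[of x y] 1(3) 2(3) by simp
  next
    fix z
    assume z: "z \<in> {z \<in> carrier_vec (n\<^sub>1 + n\<^sub>2). m\<^sub>1 @\<^sub>v m\<^sub>2 \<le> ?M *\<^sub>v z}"
    let ?x = "vec_first z n\<^sub>1" and ?y = "vec_last z n\<^sub>2"
    have eq: "?x @\<^sub>v ?y = z"
      using z by simp
    then have "?x \<in> S\<^sub>1 \<and> ?y \<in> S\<^sub>2"
      using le[of ?x ?y] z 1(3) 2(3) by simp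
    with eq show "z \<in> ?S"
      by (metis (mono_tags, lifting) mem_Collect_eq)
  qed
  then show ?thesis
    unfolding H_representation_def using 1 2 by simp
qed

lemma H_representation_blocks:
  assumes "\<And>d. d \<in> set ds \<Longrightarrow> H_representation (n d) (S d) (M d) (m d)"
  shows "H_representation (\<Sum>d\<leftarrow>ds. n d) (vconcat ` listset (map S ds))
    (diag_block_mat (map M ds)) (vconcat (map m ds))"
  using assms
proof (induction ds)
  case Nil
  show ?case
    by (auto simp: H_representation_def vconcat_Nil less_eq_vec_def)
next
  case (Cons d ds)
  have "vconcat ` listset (map S (d # ds))
      = {x @\<^sub>v y | x y. x \<in> S d \<and> y \<in> vconcat ` listset (map S ds)}"
    by (force simp: set_Cons_def vconcat_Cons)
  then show ?case
    using H_representation_two_blocks[of "n d" "S d" "M d" "m d", OF _ Cons.IH] Cons.prems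
    by (simp add: vconcat_Cons Let_def)
qed


section \<open>Port values as global coordinates\<close>

lemma set_all_func:
  "p \<in> set (all_func L) \<longleftrightarrow>
    fst p < length (nodes L) \<and> snd p < length (func_ports (nodes L ! fst p))"
  by (cases p) (force simp: all_func_def)

lemma set_all_res:
  "p \<in> set (all_res L) \<longleftrightarrow>
    fst p < length (nodes L) \<and> snd p < length (res_ports (nodes L ! fst p))"
  by (cases p) (force simp: all_res_def)

lemma set_ext_func_subset: "set (ext_func L) \<subseteq> set (all_func L)"
  by (auto simp: ext_func_def)

lemma set_ext_res_subset: "set (ext_res L) \<subseteq> set (all_res L)"
  by (auto simp: ext_res_def)

text \<open>The actual dimensions of the port values agree with the declared ones, on which the coordinate
  functions rely.\<close>

lemma port_dims:
  assumes "\<forall>P \<in> set Ps. euclidean_subposet P" and "xs \<in> prod_carrier Ps"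
  shows "map dim_vec xs = map fst Ps"
  using assms unfolding prod_carrier_def
  by (auto simp: listset_map_iff euclidean_subposet_def intro!: nth_equalityI)
    (metis (no_types, lifting) carrier_vecD mem_Collect_eq nth_mem subsetD)

lemma edge_ports:
  assumes "linear_codesign_problem L" and "(r, f) \<in> edges L"
  shows "r \<in> set (all_res L)" and "f \<in> set (all_func L)" and "res_port L r = func_port L f"
  using assms unfolding linear_codesign_problem_def by auto

text \<open>The facts below locate the port values of a componentwise feasible assignment in its global
  vector. They apply alike to assignments with edge inequalities and with edge equalities.\<close>

context
  fixes L z
  assumes L: "linear_codesign_problem L" and z: "z \<in> componentwise_feasible L"
begin

lemma length_assignment: "length z = length (nodes L)"
  using z by (simp add: componentwise_feasible_def listset_map_iff)

lemma node_feasible: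
  assumes "d < length (nodes L)"
  shows "z ! d \<in> ldp (nodes L ! d)"
  using z assms by (simp add: componentwise_feasible_def listset_map_iff)

lemma node_values_in_carrier:
  assumes "d < length (nodes L)"
  shows "fst (z ! d) \<in> prod_carrier (func_ports (nodes L ! d))"
    and "snd (z ! d) \<in> prod_carrier (res_ports (nodes L ! d))"
proof -
  have "linear_design_problem (nodes L ! d)"
    using L assms by (simp add: linear_codesign_problem_def)
  then have "z ! d \<in> prod_carrier (func_ports (nodes L ! d)) \<times> prod_carrier (res_ports (nodes L ! d))"
    using node_feasible[OF assms] unfolding linear_design_problem_def design_problem_def by blast
  then show "fst (z ! d) \<in> prod_carrier (func_ports (nodes L ! d))"
    and "snd (z ! d) \<in> prod_carrier (res_ports (nodes L ! d))" by auto
qed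

lemma node_value_dims:
  assumes "d < length (nodes L)"
  shows "map dim_vec (fst (z ! d)) = map fst (func_ports (nodes L ! d))"
    and "map dim_vec (snd (z ! d)) = map fst (res_ports (nodes L ! d))"
proof -
  have "linear_design_problem (nodes L ! d)"
    using L assms by (simp add: linear_codesign_problem_def)
  then show "map dim_vec (fst (z ! d)) = map fst (func_ports (nodes L ! d))"
    and "map dim_vec (snd (z ! d)) = map fst (res_ports (nodes L ! d))"
    using port_dims node_values_in_carrier[OF assms] unfolding linear_design_problem_def by auto
qed

lemma fval_in_port:
  assumes "p \<in> set (all_func L)"
  shows "fval z p \<in> snd (func_port L p)"
  using assms node_values_in_carrier(1)[of "fst p"]
  by (simp add: set_all_func prod_carrier_def listset_map_iff fval_def func_port_def)

lemma rval_in_port: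
  assumes "p \<in> set (all_res L)"
  shows "rval z p \<in> snd (res_port L p)"
  using assms node_values_in_carrier(2)[of "fst p"]
  by (simp add: set_all_res prod_carrier_def listset_map_iff rval_def res_port_def)

lemma dim_fval:
  assumes "p \<in> set (all_func L)"
  shows "dim_vec (fval z p) = fst (func_port L p)"
  using assms node_value_dims(1)[of "fst p"]
  by (auto simp: set_all_func fval_def func_port_def list_eq_iff_nth_eq)

lemma dim_rval:
  assumes "p \<in> set (all_res L)"
  shows "dim_vec (rval z p) = fst (res_port L p)"
  using assms node_value_dims(2)[of "fst p"]
  by (auto simp: set_all_res rval_def res_port_def list_eq_iff_nth_eq)

lemma node_vector_dims: "map dim_vec (map stack z) = map node_dim (nodes L)"
proof (rule nth_equalityI)
  fix d
  assume "d < length (map dim_vec (map stack z))"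
  then have "d < length (nodes L)" and "d < length z"
    by (simp_all add: length_assignment)
  then show "map dim_vec (map stack z) ! d = map node_dim (nodes L) ! d"
    using node_value_dims[of d]
    by (simp add: stack_eq_vconcat dim_vconcat node_dim_def prod_dim_def)
qed (simp add: length_assignment)

lemma dim_global_vec: "dim_vec (global_vec z) = global_dim L"
  unfolding global_vec_def dim_vconcat node_vector_dims global_dim_def ..

lemma node_coordinate:
  assumes "d < length (nodes L)" and "k < node_dim (nodes L ! d)"
  shows "node_offset L d + k < global_dim L"
    and "global_vec z $ (node_offset L d + k) = stack (z ! d) $ k"
proof -
  have dim: "dim_vec (stack (z ! d)) = node_dim (nodes L ! d)"
    using arg_cong[OF node_vector_dims, of "\<lambda>xs. xs ! d"] assms(1) by (simp add: length_assignment)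
  have offset: "sum_list (map dim_vec (take d (map stack z))) = node_offset L d"
    unfolding take_map[symmetric] node_vector_dims node_offset_def ..
  note index = vconcat_index[of d "map stack z" k, unfolded offset]
  show "node_offset L d + k < global_dim L"
    using index(1) assms dim dim_global_vec by (simp add: length_assignment global_vec_def)
  show "global_vec z $ (node_offset L d + k) = stack (z ! d) $ k"
    using index(2) assms dim by (simp add: length_assignment global_vec_def)
qed

lemma func_coordinate:
  assumes p: "p \<in> set (all_func L)" and k: "k < fst (func_port L p)"
  shows "func_coord L p k < global_dim L"
    and "global_vec z $ func_coord L p k = fval z p $ k"
proof -
  let ?d = "fst p" and ?j = "snd p"
  let ?x = "z ! ?d" and ?node = "nodes L ! fst p"
  have d: "?d < length (nodes L)" and j: "?j < length (func_ports ?node)"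
    using p by (simp_all add: set_all_func)
  note dims = node_value_dims[OF d]
  have len: "length (fst ?x) = length (func_ports ?node)"
    using dims(1) by (metis length_map)
  have offset: "sum_list (map dim_vec (take ?j (fst ?x @ snd ?x))) = prod_dim (take ?j (func_ports ?node))"
    using j by (simp add: len prod_dim_def take_map[symmetric] dims(1))
  have "?j < length (fst ?x @ snd ?x)" and "k < dim_vec ((fst ?x @ snd ?x) ! ?j)"
    using j k dim_fval[OF p] by (simp_all add: len nth_append fval_def)
  note index = vconcat_index[OF this, unfolded offset]
  have "dim_vec (vconcat (fst ?x @ snd ?x)) = node_dim ?node"
    by (simp add: dim_vconcat dims node_dim_def prod_dim_def)
  then have bound: "prod_dim (take ?j (func_ports ?node)) + k < node_dim ?node"
    using index(1) by simp
  show "func_coord L p k < global_dim L"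
    using node_coordinate(1)[OF d bound] by (simp add: func_coord_def ac_simps)
  show "global_vec z $ func_coord L p k = fval z p $ k"
    using node_coordinate(2)[OF d bound] index(2) j
    by (simp add: func_coord_def ac_simps stack_eq_vconcat len nth_append fval_def)
qed

lemma res_coordinate:
  assumes p: "p \<in> set (all_res L)" and k: "k < fst (res_port L p)"
  shows "res_coord L p k < global_dim L"
    and "global_vec z $ res_coord L p k = rval z p $ k"
proof -
  let ?d = "fst p" and ?i = "snd p"
  let ?x = "z ! ?d" and ?node = "nodes L ! fst p"
  let ?n = "length (fst ?x) + ?i"
  have d: "?d < length (nodes L)" and i: "?i < length (res_ports ?node)"
    using p by (simp_all add: set_all_res)
  note dims = node_value_dims[OF d]
  have len: "length (snd ?x) = length (res_ports ?node)"
    using dims(2) by (metis length_map)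
  \<comment> \<open>In the joint port list, the resource ports come after all functionality ports.\<close>
  have offset: "sum_list (map dim_vec (take ?n (fst ?x @ snd ?x)))
      = prod_dim (func_ports ?node) + prod_dim (take ?i (res_ports ?node))"
    by (simp add: prod_dim_def take_map[symmetric] dims)
  have "?n < length (fst ?x @ snd ?x)" and "k < dim_vec ((fst ?x @ snd ?x) ! ?n)"
    using i k dim_rval[OF p] by (simp_all add: len nth_append rval_def)
  note index = vconcat_index[OF this, unfolded offset]
  have "dim_vec (vconcat (fst ?x @ snd ?x)) = node_dim ?node"
    by (simp add: dim_vconcat dims node_dim_def prod_dim_def)
  then have bound: "prod_dim (func_ports ?node) + prod_dim (take ?i (res_ports ?node)) + k < node_dim ?node"
    using index(1) by simp
  show "res_coord L p k < global_dim L"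
    using node_coordinate(1)[OF d bound] by (simp add: res_coord_def ac_simps)
  show "global_vec z $ res_coord L p k = rval z p $ k"
    using node_coordinate(2)[OF d bound] index(2)
    by (simp add: res_coord_def ac_simps stack_eq_vconcat nth_append rval_def)
qed

end


section \<open>Wiring equalities and external selection as matrices\<close>

text \<open>The sign of a row does not affect its kernel.\<close>

lemma wire_row_orthogonal_iff:
  assumes "is_wire_row n (a, b) v" and "a < n" and "b < n" and "x \<in> carrier_vec n"
  shows "v \<bullet> x = 0 \<longleftrightarrow> x $ a = x $ b"
  using assms unfolding is_wire_row_def
  by (auto simp: minus_scalar_prod_distrib[of _ n])

lemma mult_mat_vec_eq_0_iff: "E *\<^sub>v x = 0\<^sub>v (dim_row E) \<longleftrightarrow> (\<forall>v \<in> set (rows E). v \<bullet> x = 0)"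
  by (auto simp: vec_eq_iff rows_def)

text \<open>The rows of \<open>E\<close> and the wires correspond to each other up to order, sign and repetition, none of
  which affects the kernel. Agreement on all wires of an edge is agreement of the two port vectors,
  because both ends have the same dimension.\<close>

lemma wiring_matrix_kernel_iff:
  assumes L: "linear_codesign_problem L" and z: "z \<in> componentwise_feasible L"
    and E: "wiring_matrix L E"
  shows "E *\<^sub>v global_vec z = 0\<^sub>v (dim_row E) \<longleftrightarrow> (\<forall>(r, f) \<in> edges L. rval z r = fval z f)"
proof -
  let ?x = "global_vec z" and ?n = "global_dim L"
  have x: "?x \<in> carrier_vec ?n"
    by (rule carrier_vecI) (rule dim_global_vec[OF L z])
  have bound: "fst w < ?n" "snd w < ?n" if "w \<in> wires L" for w
    using that res_coordinate(1)[OF L z] func_coordinate(1)[OF L z] edge_ports[OF L]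
    unfolding wires_def by auto
  have row: "v \<bullet> ?x = 0 \<longleftrightarrow> ?x $ fst w = ?x $ snd w"
    if "w \<in> wires L" "is_wire_row ?n w v" for w v
    using wire_row_orthogonal_iff[of ?n "fst w" "snd w" v ?x] that bound x by simp
  have "E *\<^sub>v ?x = 0\<^sub>v (dim_row E) \<longleftrightarrow> (\<forall>w \<in> wires L. ?x $ fst w = ?x $ snd w)"
    unfolding mult_mat_vec_eq_0_iff using E row unfolding wiring_matrix_def by metis
  also have "\<dots> \<longleftrightarrow> (\<forall>(r, f) \<in> edges L. \<forall>k < fst (res_port L r). ?x $ res_coord L r k = ?x $ func_coord L f k)"
    unfolding wires_def by fastforce
  also have "\<dots> \<longleftrightarrow> (\<forall>(r, f) \<in> edges L. rval z r = fval z f)"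
  proof -
    have "(\<forall>k < fst (res_port L r). ?x $ res_coord L r k = ?x $ func_coord L f k)
        \<longleftrightarrow> rval z r = fval z f" if e: "(r, f) \<in> edges L" for r f
      using edge_ports[OF L e] res_coordinate(2)[OF L z, of r] func_coordinate(2)[OF L z, of f]
        dim_rval[OF L z, of r] dim_fval[OF L z, of f]
      by (simp add: vec_eq_iff)
    then show ?thesis by blast
  qed
  finally show ?thesis .
qed

lemma selection_mult_vec:
  fixes x :: "'a :: semiring_1 vec"
  assumes "set cs \<subseteq> {..<n}" and "x \<in> carrier_vec n"
  shows "list_of_vec (mat_of_rows n (map (unit_vec n) cs) *\<^sub>v x) = map (\<lambda>i. x $ i) cs"
proof (rule nth_equalityI)
  fix i
  assume "i < length (list_of_vec (mat_of_rows n (map (unit_vec n) cs) *\<^sub>v x))"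
  then have i: "i < length cs" by simp
  with assms(1) have "cs ! i < n" using nth_mem by blast
  with i assms(2) show "list_of_vec (mat_of_rows n (map (unit_vec n) cs) *\<^sub>v x) ! i = map (\<lambda>i. x $ i) cs ! i"
    by simp
qed simp

text \<open>Both sides list the coordinates of the external ports in the same order: functionality ports
  first, and within each port by increasing index.\<close>

lemma ext_selection_mult_global_vec:
  assumes L: "linear_codesign_problem L" and z: "z \<in> componentwise_feasible L"
  shows "ext_selection L *\<^sub>v global_vec z = stack (map (fval z) (ext_func L), map (rval z) (ext_res L))"
proof -
  let ?x = "global_vec z"
  note ext = set_ext_func_subset[of L] set_ext_res_subset[of L]
  have bounds: "set (ext_coords L) \<subseteq> {..<global_dim L}"
    using ext func_coordinate(1)[OF L z] res_coordinate(1)[OF L z]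
    by (fastforce simp: ext_coords_def)
  have f: "map (\<lambda>k. ?x $ func_coord L p k) [0..<fst (func_port L p)] = list_of_vec (fval z p)"
    if "p \<in> set (ext_func L)" for p
    using that ext(1) func_coordinate(2)[OF L z, of p] dim_fval[OF L z, of p]
    by (auto simp: list_of_vec_map)
  have r: "map (\<lambda>k. ?x $ res_coord L p k) [0..<fst (res_port L p)] = list_of_vec (rval z p)"
    if "p \<in> set (ext_res L)" for p
    using that ext(2) res_coordinate(2)[OF L z, of p] dim_rval[OF L z, of p]
    by (auto simp: list_of_vec_map)
  have "list_of_vec (ext_selection L *\<^sub>v ?x) = map (\<lambda>i. ?x $ i) (ext_coords L)"
    unfolding ext_selection_def
    by (rule selection_mult_vec[OF bounds]) (rule carrier_vecI[OF dim_global_vec[OF L z]])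
  also have "\<dots> = concat (map (\<lambda>p. list_of_vec (fval z p)) (ext_func L))
      @ concat (map (\<lambda>p. list_of_vec (rval z p)) (ext_res L))"
    unfolding ext_coords_def map_append map_concat map_map o_def
    by (intro arg_cong2[where f = "(@)"] arg_cong[where f = concat] map_cong refl) (simp_all add: f r)
  also have "\<dots> = list_of_vec (stack (map (fval z) (ext_func L), map (rval z) (ext_res L)))"
    by (simp add: stack_def list_of_vec_vconcat o_def)
  finally show ?thesis
    by (simp add: list_of_vec_inject)
qed


section \<open>Tightening edge inequalities\<close>

text \<open>The combinatorial core of the tightening. The vertices \<open>r\<close> and \<open>f\<close> of a bipartite
  graph \<open>W\<close> carry labels; if every edge has an endpoint on no other edge, new labels can be copied
  across single edges so that the ends of each edge agree. Each component is a star, and its leaves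
  take over the label of its centre. That each new label is either the old one or the old label of
  a neighbour is what later keeps the values in the port posets, moves them in the permitted
  direction, and fixes the external ports.\<close>

lemma star_copy:
  fixes a :: "'r \<Rightarrow> 'v" and b :: "'f \<Rightarrow> 'v"
  assumes star: "\<And>r f. (r, f) \<in> W \<Longrightarrow>
      (\<forall>f'. (r, f') \<in> W \<longrightarrow> f' = f) \<or> (\<forall>r'. (r', f) \<in> W \<longrightarrow> r' = r)"
  obtains a' b' where "\<And>r f. (r, f) \<in> W \<Longrightarrow> a' r = b' f"
    and "\<And>r. a' r = a r \<or> (\<exists>f. (r, f) \<in> W \<and> a' r = b f)"
    and "\<And>f. b' f = b f \<or> (\<exists>r. (r, f) \<in> W \<and> b' f = a r)"
proof -
  \<comment> \<open>\<open>pendant r f\<close>: the edge is the only one at \<open>f\<close>, so \<open>f\<close> may be overwritten by the label of \<open>r\<close>.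
    \<open>spoke r f\<close>: another edge meets \<open>f\<close>, so \<open>f\<close> is the centre and \<open>r\<close> a leaf that is overwritten.
    An isolated edge counts as pendant.\<close>
  define pendant where "pendant r f \<longleftrightarrow> (r, f) \<in> W \<and> (\<forall>r'. (r', f) \<in> W \<longrightarrow> r' = r)" for r f
  define spoke where "spoke r f \<longleftrightarrow> (r, f) \<in> W \<and> \<not> pendant r f" for r f
  define a' where "a' r = (if \<exists>f. spoke r f then b (SOME f. spoke r f) else a r)" for r
  define b' where "b' f = (if \<exists>r. pendant r f then a (SOME r. pendant r f) else b f)" for f
  have "a' r = b' f" if e: "(r, f) \<in> W" for r f
  proof (cases "pendant r f")
    case True
    \<comment> \<open>A spoke at \<open>r\<close> would make \<open>r\<close> a leaf, with its only edge not pendant.\<close>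
    have "\<not> spoke r f'" for f'
      using True e star[of r f'] unfolding spoke_def pendant_def by metis
    moreover have "(SOME r. pendant r f) = r"
      using True by (rule some_equality) (use True in \<open>auto simp: pendant_def\<close>)
    ultimately show ?thesis
      using True unfolding a'_def b'_def by auto
  next
    case False
    then have spoke: "spoke r f"
      using e unfolding spoke_def by simp
    have "f' = f" if "spoke r f'" for f'
      using False e that star[of r f] unfolding spoke_def pendant_def by blast
    with spoke have "(SOME f. spoke r f) = f"
      by (rule some_equality)
    moreover have "\<not> pendant r' f" for r'
      using False e unfolding pendant_def by blast
    ultimately show ?thesis
      using spoke unfolding a'_def b'_def by auto
  qed
  moreover have "a' r = a r \<or> (\<exists>f. (r, f) \<in> W \<and> a' r = b f)" for r
    using someI_ex[of "spoke r"] unfolding a'_def spoke_def by auto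
  moreover have "b' f = b f \<or> (\<exists>r. (r, f) \<in> W \<and> b' f = a r)" for f
    using someI_ex[of "\<lambda>r. pendant r f"] unfolding b'_def pendant_def by auto
  ultimately show ?thesis
    using that by blast
qed

text \<open>Raising resources and lowering functionalities, within the port posets, preserves the feasibility
  of each node: this is the upper-set condition on design problems, applied to all ports at once.\<close>

lemma componentwise_feasible_relax:
  assumes L: "linear_codesign_problem L" and z: "z \<in> componentwise_feasible L"
    and a: "\<And>p. p \<in> set (all_res L) \<Longrightarrow> a p \<in> snd (res_port L p) \<and> rval z p \<le> a p"
    and b: "\<And>p. p \<in> set (all_func L) \<Longrightarrow> b p \<in> snd (func_port L p) \<and> b p \<le> fval z p"
  obtains z' where "z' \<in> componentwise_feasible L"
    and "\<And>p. p \<in> set (all_res L) \<Longrightarrow> rval z' p = a p"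
    and "\<And>p. p \<in> set (all_func L) \<Longrightarrow> fval z' p = b p"
proof -
  define yF where "yF d = map (\<lambda>j. b (d, j)) [0..<length (func_ports (nodes L ! d))]" for d
  define yR where "yR d = map (\<lambda>i. a (d, i)) [0..<length (res_ports (nodes L ! d))]" for d
  define z' where "z' = map (\<lambda>d. (yF d, yR d)) [0..<length (nodes L)]"
  have "(yF d, yR d) \<in> ldp (nodes L ! d)" if d: "d < length (nodes L)" for d
  proof -
    let ?node = "nodes L ! d"
    have dp: "design_problem (prod_carrier (func_ports ?node)) prod_le (prod_carrier (res_ports ?node)) prod_le (ldp ?node)"
      using L d unfolding linear_codesign_problem_def linear_design_problem_def by auto
    have len: "length (fst (z ! d)) = length (func_ports ?node)" "length (snd (z ! d)) = length (res_ports ?node)"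
      using node_value_dims[OF L z d] by (metis length_map)+
    have bd: "b (d, j) \<in> snd (func_ports ?node ! j)" "b (d, j) \<le> fst (z ! d) ! j"
      if "j < length (func_ports ?node)" for j
      using b[of "(d, j)"] that d by (simp_all add: set_all_func func_port_def fval_def)
    have ad: "a (d, i) \<in> snd (res_ports ?node ! i)" "snd (z ! d) ! i \<le> a (d, i)"
      if "i < length (res_ports ?node)" for i
      using a[of "(d, i)"] that d by (simp_all add: set_all_res res_port_def rval_def)
    have "yF d \<in> prod_carrier (func_ports ?node)" "prod_le (yF d) (fst (z ! d))"
      using bd by (simp_all add: yF_def prod_carrier_def listset_map_iff prod_le_def list_all2_conv_all_nth len)
    moreover have "yR d \<in> prod_carrier (res_ports ?node)" "prod_le (snd (z ! d)) (yR d)"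
      using ad by (simp_all add: yR_def prod_carrier_def listset_map_iff prod_le_def list_all2_conv_all_nth len)
    moreover have "(fst (z ! d), snd (z ! d)) \<in> ldp ?node"
      using node_feasible[OF L z d] by simp
    ultimately show ?thesis
      using dp unfolding design_problem_def by blast
  qed
  then have "z' \<in> componentwise_feasible L"
    by (simp add: componentwise_feasible_def listset_map_iff z'_def)
  moreover have "rval z' p = a p" if "p \<in> set (all_res L)" for p
    using that by (simp add: set_all_res rval_def z'_def yR_def)
  moreover have "fval z' p = b p" if "p \<in> set (all_func L)" for p
    using that by (simp add: set_all_func fval_def z'_def yF_def)
  ultimately show ?thesis
    using that by blast
qed

text \<open>A copied value moves in the permitted direction because of the edge inequality, and stays in the
  port poset because the two ends of an edge carry the same poset.\<close>

lemma star_wired_tighten: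
  assumes L: "linear_codesign_problem L" and star: "star_wired L"
    and z: "z \<in> componentwise_feasible L" and le: "\<forall>(r, f) \<in> edges L. rval z r \<le> fval z f"
  obtains z' where "z' \<in> full_feasible L"
    and "map (fval z') (ext_func L) = map (fval z) (ext_func L)"
    and "map (rval z') (ext_res L) = map (rval z) (ext_res L)"
proof -
  have "(\<forall>f'. (r, f') \<in> edges L \<longrightarrow> f' = f) \<or> (\<forall>r'. (r', f) \<in> edges L \<longrightarrow> r' = r)"
    if "(r, f) \<in> edges L" for r f
    using star that unfolding star_wired_def by blast
  from star_copy[of "edges L" "rval z" "fval z", OF this]
  obtain a b where eq: "\<And>r f. (r, f) \<in> edges L \<Longrightarrow> a r = b f"
    and a: "\<And>r. a r = rval z r \<or> (\<exists>f. (r, f) \<in> edges L \<and> a r = fval z f)"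
    and b: "\<And>f. b f = fval z f \<or> (\<exists>r. (r, f) \<in> edges L \<and> b f = rval z r)"
    by blast
  have raise: "a p \<in> snd (res_port L p) \<and> rval z p \<le> a p" if "p \<in> set (all_res L)" for p
    using a[of p]
  proof (elim disjE exE conjE)
    fix f
    assume e: "(p, f) \<in> edges L" "a p = fval z f"
    then show ?thesis
      using edge_ports(2,3)[OF L e(1)] fval_in_port[OF L z, of f] le by auto
  qed (use that rval_in_port[OF L z] in simp)
  have lower: "b p \<in> snd (func_port L p) \<and> b p \<le> fval z p" if "p \<in> set (all_func L)" for p
    using b[of p]
  proof (elim disjE exE conjE)
    fix r
    assume e: "(r, p) \<in> edges L" "b p = rval z r"
    then show ?thesis
      using edge_ports(1,3)[OF L e(1)] rval_in_port[OF L z, of r] le by auto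
  qed (use that fval_in_port[OF L z] in simp)
  obtain z' where z': "z' \<in> componentwise_feasible L"
    and r: "\<And>p. p \<in> set (all_res L) \<Longrightarrow> rval z' p = a p"
    and f: "\<And>p. p \<in> set (all_func L) \<Longrightarrow> fval z' p = b p"
    by (rule componentwise_feasible_relax[OF L z raise lower]) blast+
  have "rval z' p = fval z' q" if "(p, q) \<in> edges L" for p q
    using edge_ports[OF L that] eq[OF that] r f by simp
  with z' have "z' \<in> full_feasible L"
    by (auto simp: full_feasible_def)
  moreover have "fval z' p = fval z p" if "p \<in> set (ext_func L)" for p
    using that f[of p] b[of p] by (force simp: ext_func_def)
  moreover have "rval z' p = rval z p" if "p \<in> set (ext_res L)" for p
    using that r[of p] a[of p] by (force simp: ext_res_def)
  ultimately show ?thesis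
    using that by simp
qed

lemma ext_feasible_of_full_feasible:
  assumes L: "linear_codesign_problem L" and "z \<in> full_feasible L"
  shows "(map (fval z) (ext_func L), map (rval z) (ext_res L)) \<in> ext_feasible L"
proof -
  have z: "z \<in> componentwise_feasible L" and eq: "\<forall>(r, f) \<in> edges L. rval z r = fval z f"
    using assms(2) by (auto simp: full_feasible_def)
  have "map (fval z) (ext_func L) \<in> prod_carrier (system_func L)"
    using fval_in_port[OF L z subsetD[OF set_ext_func_subset nth_mem]]
    by (simp add: prod_carrier_def system_func_def listset_map_iff)
  moreover have "map (rval z) (ext_res L) \<in> prod_carrier (system_res L)"
    using rval_in_port[OF L z subsetD[OF set_ext_res_subset nth_mem]]
    by (simp add: prod_carrier_def system_res_def listset_map_iff)
  moreover have "\<forall>(r, f) \<in> edges L. rval z r \<le> fval z f"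
    using eq by auto
  ultimately show ?thesis
    using z unfolding ext_feasible_def by blast
qed

lemma ext_feasible_eq_full_feasible_image:
  assumes L: "linear_codesign_problem L" and star: "star_wired L"
  shows "ext_feasible L = (\<lambda>z. (map (fval z) (ext_func L), map (rval z) (ext_res L))) ` full_feasible L"
proof (intro equalityI subsetI)
  fix x
  assume "x \<in> ext_feasible L"
  then obtain z where z: "z \<in> componentwise_feasible L" "\<forall>(r, f) \<in> edges L. rval z r \<le> fval z f"
    and x: "x = (map (fval z) (ext_func L), map (rval z) (ext_res L))"
    unfolding ext_feasible_def by blast
  obtain z' where "z' \<in> full_feasible L"
    and "map (fval z') (ext_func L) = map (fval z) (ext_func L)"
    and "map (rval z') (ext_res L) = map (rval z) (ext_res L)"
    using star_wired_tighten[OF L star z] by blast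
  then show "x \<in> (\<lambda>z. (map (fval z) (ext_func L), map (rval z) (ext_res L))) ` full_feasible L"
    unfolding x by (intro image_eqI[of _ _ z']) simp_all
qed (use ext_feasible_of_full_feasible[OF L] in blast)


section \<open>The system-level feasible sets\<close>

theorem lemma4:
  fixes L :: codesign and N :: nat
    and M :: "nat \<Rightarrow> real mat" and m :: "nat \<Rightarrow> real vec"
    and M_blk E S_ext :: "real mat" and m_blk :: "real vec"
    and ldp_tot_full :: "real vec set"
  assumes "linear_codesign_problem L"
    and "N = length (nodes L)"
    and "\<And>d. d < N \<Longrightarrow>
      H_representation (node_dim (nodes L ! d)) (stack ` ldp (nodes L ! d)) (M d) (m d)"
    and "M_blk = diag_block_mat (map M [0..<N])"
    and "m_blk = vconcat (map m [0..<N])"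
    and "wiring_matrix L E"
    and "S_ext = ext_selection L"
    and "ldp_tot_full =
      {z \<in> carrier_vec (global_dim L). M_blk *\<^sub>v z \<ge> m_blk \<and> E *\<^sub>v z = 0\<^sub>v (dim_row E)}"
  shows "global_vec ` full_feasible L = ldp_tot_full \<and>
    polyhedron_in (global_dim L) ldp_tot_full \<and>
    (star_wired L \<longrightarrow> stack ` ext_feasible L = {z_ext. \<exists>z \<in> ldp_tot_full. z_ext = S_ext *\<^sub>v z})"
proof (intro conjI impI)
  note L = assms(1)
  let ?n = "global_dim L"
  have dims: "(\<Sum>d\<leftarrow>[0..<N]. node_dim (nodes L ! d)) = ?n"
  proof -
    have "map (\<lambda>d. node_dim (nodes L ! d)) [0..<N] = map node_dim (nodes L)"
      unfolding assms(2) by (rule nth_equalityI) simp_all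
    then show ?thesis by (simp only: global_dim_def)
  qed
  have comp: "vconcat ` listset (map (\<lambda>d. stack ` ldp (nodes L ! d)) [0..<N])
      = global_vec ` componentwise_feasible L"
  proof -
    have "map (\<lambda>d. stack ` ldp (nodes L ! d)) [0..<N] = map ((`) stack) (map ldp (nodes L))"
      unfolding assms(2) by (rule nth_equalityI) simp_all
    then show ?thesis
      unfolding componentwise_feasible_def global_vec_def
      by (simp only: map_image_listset[symmetric] image_image)
  qed
  have H: "H_representation ?n (global_vec ` componentwise_feasible L) M_blk m_blk"
    using H_representation_blocks[of "[0..<N]" "\<lambda>d. node_dim (nodes L ! d)"
        "\<lambda>d. stack ` ldp (nodes L ! d)" M m] assms(3)
    unfolding dims comp assms(4,5) by simp
  have full: "ldp_tot_full = global_vec ` componentwise_feasible L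
      \<inter> {z \<in> carrier_vec ?n. E *\<^sub>v z = 0\<^sub>v (dim_row E)}"
    using H unfolding assms(8) H_representation_def by blast
  have "global_vec z \<in> carrier_vec ?n" if "z \<in> componentwise_feasible L" for z
    using dim_global_vec[OF L that] by (rule carrier_vecI)
  then show image: "global_vec ` full_feasible L = ldp_tot_full"
    unfolding full full_feasible_def
    using wiring_matrix_kernel_iff[OF L _ assms(6)] by auto
  have "dim_col E = ?n"
    using assms(6) unfolding wiring_matrix_def by simp
  then show "polyhedron_in ?n ldp_tot_full"
    unfolding full by (intro polyhedron_in_Int polyhedron_of_H_representation[OF H] polyhedron_kernel)
  assume star: "star_wired L"
  have "stack ` ext_feasible L = (\<lambda>z. S_ext *\<^sub>v global_vec z) ` full_feasible L"
    unfolding ext_feasible_eq_full_feasible_image[OF L star] image_image assms(7)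
    by (rule image_cong[OF refl]) (simp add: full_feasible_def ext_selection_mult_global_vec[OF L])
  then show "stack ` ext_feasible L = {z_ext. \<exists>z \<in> ldp_tot_full. z_ext = S_ext *\<^sub>v z}"
    unfolding image[symmetric] by blast
qed

end
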